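(* Let $d\ge 3$ be an integer, let $G$ be a $\{C_3,C_4\}$-free graph of maximum degree $d$, and let $M$ be an induced matching of $G$ produced by applying Local Search to $G$. Then the following statements hold. (i) If $xy$ is an edge in $M$, then $pc_G(M,xy)\leq 2d-1$. (ii) $|M|\geq\dfrac{m(G)}{d^2}$.
   Context: Graphs are finite, simple, and undirected; $V(G)$, $E(G)$ are the vertex and edge sets and $m(G)=|E(G)|$. $C_n$ is the cycle of order $n$; $G$ is $\{C_3,C_4\}$-free if it contains neither $C_3$ nor $C_4$ as an induced subgraph. A set $M\subseteq E(G)$ is an induced matching of $G$ if the subgraph of $G$ induced by the set of vertices incident with edges in $M$ is $1$-regular (the empty set is an induced matching). For an edge $e$ of $G$, $C_G(e)=\{f\in E(G):\mathrm{dist}_{L(G)}(e,f)\leq 2\}$, where $L(G)$ is the line graph of $G$ (so $C_G(e)$ consists of $e$, all edges sharing a vertex with $e$, and all edges joined to $e$ by an edge of $G$). For a set $M$ of edges and $e\in M$, $PC_G(M,e)=C_G(e)\setminus\bigcup_{f\in M\setminus\{e\}}C_G(f)$ and $pc_G(M,e)=|PC_G(M,e)|$. Local Search is the following algorithm on input $G$: start with $M=\emptyset$ and repeat the following iteration: (1) if $M\cup\{e\}$ is an induced matching of $G$ for some edge $e\in E(G)\setminus M$, replace $M$ by $M\cup\{e\}$; (2) if $(M\setminus\{e\})\cup\{e',e''\}$ is an induced matching of $G$ for some three distinct edges $e\in M$ and $e',e''\in E(G)\setminus M$, replace $M$ by $(M\setminus\{e\})\cup\{e',e''\}$. The choices are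 arbitrary. Stop when $|M|$ does not increase during one iteration (i.e. neither (1) nor (2) is possible), and return $M$. *)

theory Defs
  imports Complex_Main "HOL-Library.Extended_Nat"
begin

record 'a graph =
  verts :: "'a set"
  edges :: "'a set set"

definition simple_graph :: "'a graph \<Rightarrow> bool" where
  "simple_graph G \<longleftrightarrow> finite (verts G) \<and> (\<forall>e\<in>edges G. e \<subseteq> verts G \<and> card e = 2)"

definition degree :: "'a graph \<Rightarrow> 'a \<Rightarrow> nat" where
  "degree G v = card {e \<in> edges G. v \<in> e}"

text \<open>The \<open>insert 0\<close> only fixes the value for the graph without vertices.\<close>

definition max_degree :: "'a graph \<Rightarrow> nat" where
  "max_degree G = Max (insert 0 (degree G ` verts G))"

definition regular :: "nat \<Rightarrow> 'a graph \<Rightarrow> bool" where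
  "regular k G \<longleftrightarrow> (\<forall>v\<in>verts G. degree G v = k)"

definition induced_subgraph :: "'a graph \<Rightarrow> 'a set \<Rightarrow> 'a graph" where
  "induced_subgraph G S = \<lparr>verts = S, edges = {e \<in> edges G. e \<subseteq> S}\<rparr>"

definition isomorphic :: "'a graph \<Rightarrow> 'b graph \<Rightarrow> bool" where
  "isomorphic G H \<longleftrightarrow>
     (\<exists>f. bij_betw f (verts G) (verts H) \<and>
       (\<forall>u\<in>verts G. \<forall>v\<in>verts G. {u, v} \<in> edges G \<longleftrightarrow> {f u, f v} \<in> edges H))"

text \<open>This is a simple graph only for \<open>n \<ge> 3\<close>.\<close>

definition cycle_graph :: "nat \<Rightarrow> nat graph" where
  "cycle_graph n = \<lparr>verts = {..<n}, edges = {{i, Suc i mod n} | i. i < n}\<rparr>"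

definition has_induced :: "'a graph \<Rightarrow> 'b graph \<Rightarrow> bool" where
  "has_induced G H \<longleftrightarrow> (\<exists>S\<subseteq>verts G. isomorphic (induced_subgraph G S) H)"

definition line_graph :: "'a graph \<Rightarrow> 'a set graph" where
  "line_graph G = \<lparr>verts = edges G,
     edges = {{e, f} | e f. e \<in> edges G \<and> f \<in> edges G \<and> e \<noteq> f \<and> e \<inter> f \<noteq> {}}\<rparr>"

definition walk :: "'a graph \<Rightarrow> 'a \<Rightarrow> 'a list \<Rightarrow> 'a \<Rightarrow> bool" where
  "walk G u p v \<longleftrightarrow> p \<noteq> [] \<and> hd p = u \<and> last p = v \<and> set p \<subseteq> verts G \<and>
     (\<forall>i. Suc i < length p \<longrightarrow> {p ! i, p ! Suc i} \<in> edges G)"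

text \<open>Vertices that are not joined by a walk have distance \<open>\<infinity>\<close>, the infimum of the empty set.\<close>

definition graph_dist :: "'a graph \<Rightarrow> 'a \<Rightarrow> 'a \<Rightarrow> enat" where
  "graph_dist G u v = (INF p\<in>{p. walk G u p v}. enat (length p - 1))"

definition conflict_set :: "'a graph \<Rightarrow> 'a set \<Rightarrow> 'a set set" where
  "conflict_set G e = {f \<in> edges G. graph_dist (line_graph G) e f \<le> 2}"

definition private_conflicts :: "'a graph \<Rightarrow> 'a set set \<Rightarrow> 'a set \<Rightarrow> 'a set set" where
  "private_conflicts G M e = conflict_set G e - (\<Union>f\<in>M - {e}. conflict_set G f)"

definition pc :: "'a graph \<Rightarrow> 'a set set \<Rightarrow> 'a set \<Rightarrow> nat" where
  "pc G M e = card (private_conflicts G M e)"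

definition induced_matching :: "'a graph \<Rightarrow> 'a set set \<Rightarrow> bool" where
  "induced_matching G M \<longleftrightarrow> M \<subseteq> edges G \<and> regular 1 (induced_subgraph G (\<Union>M))"

definition augment :: "'a graph \<Rightarrow> 'a set set \<Rightarrow> 'a set set \<Rightarrow> bool" where
  "augment G M M' \<longleftrightarrow>
     (\<exists>e. e \<in> edges G - M \<and> M' = M \<union> {e} \<and> induced_matching G M')"

definition exchange :: "'a graph \<Rightarrow> 'a set set \<Rightarrow> 'a set set \<Rightarrow> bool" where
  "exchange G M M' \<longleftrightarrow>
     (\<exists>e e' e''. e \<in> M \<and> e' \<in> edges G - M \<and> e'' \<in> edges G - M \<and> distinct [e, e', e''] \<and>
        M' = (M - {e}) \<union> {e', e''} \<and> induced_matching G M')"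

text \<open>An instruction ``if some replacement is possible, perform one'': the choice is arbitrary,
  and nothing changes exactly if no replacement is possible.\<close>

definition if_possible :: "('s \<Rightarrow> 's \<Rightarrow> bool) \<Rightarrow> 's \<Rightarrow> 's \<Rightarrow> bool" where
  "if_possible R M M' \<longleftrightarrow> (if \<exists>N. R M N then R M M' else M' = M)"

definition iteration :: "'a graph \<Rightarrow> 'a set set \<Rightarrow> 'a set set \<Rightarrow> bool" where
  "iteration G = if_possible (augment G) OO if_possible (exchange G)"

text \<open>The sets from which some run of the algorithm starts an iteration; a run continues
  only after an iteration that increased the cardinality.\<close>

inductive reachable :: "'a graph \<Rightarrow> 'a set set \<Rightarrow> bool" for G where
  start: "reachable G {}"
| continue: "reachable G M \<Longrightarrow> iteration G M M' \<Longrightarrow> card M < card M' \<Longrightarrow> reachable G M'"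

definition local_search_output :: "'a graph \<Rightarrow> 'a set set \<Rightarrow> bool" where
  "local_search_output G M \<longleftrightarrow>
     (\<exists>M0. reachable G M0 \<and> iteration G M0 M \<and> \<not> card M0 < card M)"

end

theory Submission
  imports Defs
begin

text \<open>
  Say that two edges conflict if some edge of the graph meets both of them, and let \<open>M\<close> be a local
  optimum of the two search steps. If two edges \<open>f\<close>, \<open>f'\<close> that conflict with no edge of
  \<open>M\<close> other than \<open>e\<close> did not conflict with each other, then \<open>e\<close> could be exchanged for \<open>f\<close>
  and \<open>f'\<close>. Hence the private conflicts of \<open>e\<close> conflict pairwise, and the bound in (i) is a
  bound on a set \<open>K\<close> of pairwise conflicting edges around an edge \<open>{x, y}\<close>.

  In a graph without triangles and 4-cycles such a \<open>K\<close> is covered by \<open>{x, y}\<close> and two symmetric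
  wings. The wing of \<open>(x, y)\<close> consists of the edges of \<open>K\<close> at \<open>y\<close> and the far edges: those that
  avoid \<open>x\<close> but are incident with a neighbour of \<open>x\<close> other than \<open>y\<close>. Pairing the edges at \<open>y\<close>
  with the far edges beyond \<open>x\<close>, rather than with those beyond \<open>y\<close>, is the point: the two kinds
  exclude each other almost completely, because a far edge \<open>{a, z}\<close> can conflict with \<open>{y, b}\<close>
  only through an edge \<open>{z, b}\<close>. A wing is therefore either contained in a star and misses an edge
  at its centre, or has at most two elements; in both cases it has at most \<open>d - 1\<close> elements
  (\<open>card_wing_le\<close>), and this is where \<open>d \<ge> 3\<close> enters. The total is \<open>1 + 2 * (d - 1)\<close>.

  For (ii), every edge conflicts with at most \<open>1 + 2 * d * (d - 1)\<close> edges
  (\<open>card_conflict_set_le\<close>). Since \<open>M\<close> cannot be augmented, every edge of the graph lies in the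
  conflict set of some member of \<open>M\<close>, and either it lies in two of them or it is private to one.
  Counting each edge twice therefore gives
  \<open>2 * m \<le> |M| * ((1 + 2 * d * (d - 1)) + (2 * d - 1)) = |M| * 2 * d\<^sup>2\<close>.
\<close>

section \<open>Conflicting edges\<close>

lemma finite_edges:
  assumes "simple_graph G"
  shows "finite (edges G)"
proof (rule finite_subset)
  show "edges G \<subseteq> Pow (verts G)" using assms by (auto simp: simple_graph_def)
  show "finite (Pow (verts G))" using assms by (simp add: simple_graph_def)
qed

lemma edge_endpoints_distinct:
  assumes "simple_graph G" "{u, v} \<in> edges G"
  shows "u \<noteq> v"
  using assms by (auto simp: simple_graph_def)

lemma edge_other_endpoint:
  assumes "simple_graph G" "e \<in> edges G" "u \<in> e"
  obtains v where "e = {u, v}" "v \<noteq> u"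
proof -
  have "card e = 2" using assms(1,2) by (simp add: simple_graph_def)
  then obtain p q where "e = {p, q}" "p \<noteq> q" by (auto simp: card_2_iff)
  with \<open>u \<in> e\<close> show thesis by (auto intro: that)
qed

text \<open>Edges with a common vertex are covered by this definition as well: if \<open>v\<close> is a common vertex
  of \<open>e = {u, v}\<close> and \<open>f\<close>, then \<open>e\<close> itself joins \<open>u \<in> e\<close> to \<open>v \<in> f\<close>.\<close>

definition conflicting :: "'a graph \<Rightarrow> 'a set \<Rightarrow> 'a set \<Rightarrow> bool" where
  "conflicting G e f \<longleftrightarrow> (\<exists>u\<in>e. \<exists>v\<in>f. {u, v} \<in> edges G)"

lemma conflicting_commute: "conflicting G e f \<longleftrightarrow> conflicting G f e"
  unfolding conflicting_def by (metis insert_commute)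

lemma conflicting_if_meet:
  assumes "simple_graph G" "e \<in> edges G" "e \<inter> f \<noteq> {}"
  shows "conflicting G e f"
proof -
  obtain v where "v \<in> e" "v \<in> f" using assms(3) by blast
  then obtain u where "e = {v, u}" using edge_other_endpoint assms(1,2) by metis
  then show ?thesis
    unfolding conflicting_def using assms(2) \<open>v \<in> f\<close> by (auto simp: insert_commute)
qed

lemma conflicting_refl:
  assumes "simple_graph G" "e \<in> edges G"
  shows "conflicting G e e"
proof -
  have "e \<noteq> {}" using assms by (auto simp: simple_graph_def)
  then show ?thesis using conflicting_if_meet[OF assms] by simp
qed

lemma graph_dist_le_iff:
  "graph_dist G u v \<le> enat n \<longleftrightarrow> (\<exists>p. walk G u p v \<and> length p \<le> Suc n)"
proof
  assume le: "graph_dist G u v \<le> enat n"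
  let ?L = "(\<lambda>p. enat (length p - 1)) ` {p. walk G u p v}"
  have "?L \<noteq> {}"
  proof
    assume "?L = {}"
    then have "graph_dist G u v = \<infinity>" unfolding graph_dist_def by (simp add: Inf_enat_def)
    with le show False by simp
  qed
  then have "Inf ?L \<in> ?L" by (auto simp: Inf_enat_def intro: LeastI)
  then obtain p where "walk G u p v" "graph_dist G u v = enat (length p - 1)"
    unfolding graph_dist_def by blast
  with le show "\<exists>p. walk G u p v \<and> length p \<le> Suc n" by auto
next
  assume "\<exists>p. walk G u p v \<and> length p \<le> Suc n"
  then obtain p where p: "walk G u p v" "length p \<le> Suc n" by blast
  have "graph_dist G u v \<le> enat (length p - 1)"
    unfolding graph_dist_def using p(1) by (intro INF_lower) simp
  also have "\<dots> \<le> enat n" using p(2) by simp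
  finally show "graph_dist G u v \<le> enat n" .
qed

lemma line_graph_edge_iff:
  "{e, f} \<in> edges (line_graph G) \<longleftrightarrow>
     e \<in> edges G \<and> f \<in> edges G \<and> e \<noteq> f \<and> e \<inter> f \<noteq> {}"
  unfolding line_graph_def by (auto simp: doubleton_eq_iff)

lemma conflict_set_iff:
  assumes sg: "simple_graph G" and e: "e \<in> edges G"
  shows "f \<in> conflict_set G e \<longleftrightarrow> f \<in> edges G \<and> conflicting G e f"
proof
  assume "f \<in> conflict_set G e"
  then have f: "f \<in> edges G" and dist: "graph_dist (line_graph G) e f \<le> enat 2"
    by (auto simp: conflict_set_def numeral_eq_enat)
  obtain p where w: "walk (line_graph G) e p f" and len: "length p \<le> 3"
    using dist unfolding graph_dist_le_iff by auto
  have "p \<noteq> []" using w by (simp add: walk_def)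
  with len consider "length p = 1" | "length p = 2" | "length p = 3"
    by (cases p) (auto simp: le_Suc_eq numeral_eq_Suc)
  then have "conflicting G e f"
  proof cases
    case 1
    then have "e = f" using w by (auto simp: walk_def length_Suc_conv)
    then show ?thesis using conflicting_refl[OF sg e] by simp
  next
    case 2
    then have "p = [e, f]" using w by (auto simp: walk_def length_Suc_conv numeral_eq_Suc)
    then have "{e, f} \<in> edges (line_graph G)" using w unfolding walk_def by fastforce
    then show ?thesis using conflicting_if_meet[OF sg e] by (simp add: line_graph_edge_iff)
  next
    case 3
    then obtain g where p: "p = [e, g, f]"
      using w by (auto simp: walk_def length_Suc_conv numeral_eq_Suc)
    have step: "{p ! i, p ! Suc i} \<in> edges (line_graph G)" if "Suc i < length p" for i
      using w that unfolding walk_def by blast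
    have "{e, g} \<in> edges (line_graph G)" "{g, f} \<in> edges (line_graph G)"
      using step[of 0] step[of 1] p by auto
    then have g: "g \<in> edges G" and "e \<inter> g \<noteq> {}" "g \<inter> f \<noteq> {}"
      by (auto simp: line_graph_edge_iff)
    then obtain u v where uv: "u \<in> e" "u \<in> g" "v \<in> g" "v \<in> f" by blast
    show ?thesis
    proof (cases "u = v")
      case True
      then show ?thesis using uv conflicting_if_meet[OF sg e] by blast
    next
      case False
      obtain w where "g = {u, w}" using edge_other_endpoint sg g uv(2) by metis
      with False uv(3) have "g = {u, v}" by auto
      then show ?thesis using uv g unfolding conflicting_def by blast
    qed
  qed
  with f show "f \<in> edges G \<and> conflicting G e f" ..
next
  assume "f \<in> edges G \<and> conflicting G e f"
  then have f: "f \<in> edges G" and "conflicting G e f" by auto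
  then obtain u v where uv: "u \<in> e" "v \<in> f" "{u, v} \<in> edges G"
    unfolding conflicting_def by blast
  have "\<exists>p. walk (line_graph G) e p f \<and> length p \<le> Suc 2"
  proof -
    consider "e = f" | "e \<noteq> f" "e \<inter> f \<noteq> {}" | "e \<inter> f = {}" by blast
    then show ?thesis
    proof cases
      case 1
      then have "walk (line_graph G) e [e] f"
        using e by (auto simp: walk_def line_graph_def)
      then show ?thesis by (metis length_Cons list.size(3) Suc_leI zero_less_Suc)
    next
      case 2
      then have "walk (line_graph G) e [e, f] f"
        using e f line_graph_edge_iff[of e f G] by (auto simp: walk_def) (auto simp: line_graph_def)
      then show ?thesis by force
    next
      case 3
      have "{e, {u, v}} \<in> edges (line_graph G)" "{{u, v}, f} \<in> edges (line_graph G)"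
        unfolding line_graph_edge_iff using uv e f 3 by auto
      then have "walk (line_graph G) e [e, {u, v}, f] f"
        using e f uv(3) by (auto simp: walk_def less_Suc_eq) (auto simp: line_graph_def)
      then show ?thesis by force
    qed
  qed
  then have "graph_dist (line_graph G) e f \<le> enat 2" by (simp only: graph_dist_le_iff)
  then show "f \<in> conflict_set G e" using f by (simp add: conflict_set_def numeral_eq_enat)
qed

lemma induced_matching_iff:
  assumes sg: "simple_graph G"
  shows "induced_matching G M \<longleftrightarrow>
    M \<subseteq> edges G \<and> (\<forall>e\<in>M. \<forall>f\<in>M. e \<noteq> f \<longrightarrow> \<not> conflicting G e f)"
proof
  assume "induced_matching G M"
  then have sub: "M \<subseteq> edges G"
    and deg: "\<And>v. v \<in> \<Union>M \<Longrightarrow> card {e \<in> edges G. e \<subseteq> \<Union>M \<and> v \<in> e} = 1"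
    by (auto simp: induced_matching_def regular_def induced_subgraph_def degree_def conj_assoc)
  have unique: "g = h"
    if "g \<in> edges G" "g \<subseteq> \<Union>M" "v \<in> g" "h \<in> edges G" "h \<subseteq> \<Union>M" "v \<in> h" for g h v
  proof -
    have "v \<in> \<Union>M" using that by blast
    from deg[OF this] obtain k where k: "{e \<in> edges G. e \<subseteq> \<Union>M \<and> v \<in> e} = {k}"
      by (auto simp: card_1_singleton_iff)
    have "g \<in> {e \<in> edges G. e \<subseteq> \<Union>M \<and> v \<in> e}" "h \<in> {e \<in> edges G. e \<subseteq> \<Union>M \<and> v \<in> e}"
      using that by auto
    then show ?thesis unfolding k by simp
  qed
  have "e = f" if ef: "e \<in> M" "f \<in> M" "conflicting G e f" for e f
  proof -
    obtain u v where uv: "u \<in> e" "v \<in> f" "{u, v} \<in> edges G"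
      using ef(3) unfolding conflicting_def by blast
    have "{u, v} \<subseteq> \<Union>M" using uv ef by blast
    then have "e = {u, v}" "f = {u, v}"
      using unique[of e u "{u, v}"] unique[of f v "{u, v}"] uv ef sub by auto
    then show ?thesis by simp
  qed
  with sub show "M \<subseteq> edges G \<and> (\<forall>e\<in>M. \<forall>f\<in>M. e \<noteq> f \<longrightarrow> \<not> conflicting G e f)" by blast
next
  assume *: "M \<subseteq> edges G \<and> (\<forall>e\<in>M. \<forall>f\<in>M. e \<noteq> f \<longrightarrow> \<not> conflicting G e f)"
  have "{g \<in> edges G. g \<subseteq> \<Union>M \<and> v \<in> g} = {e}" if "v \<in> e" "e \<in> M" for v e
  proof -
    have "g = e" if g: "g \<in> edges G" "g \<subseteq> \<Union>M" "v \<in> g" for g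
    proof -
      obtain w where w: "g = {v, w}" "w \<noteq> v" using edge_other_endpoint sg g(1,3) by metis
      then obtain f where f: "w \<in> f" "f \<in> M" using g(2) by blast
      then have "conflicting G e f"
        unfolding conflicting_def using w g(1) \<open>v \<in> e\<close> by blast
      then have "w \<in> e" using * f \<open>e \<in> M\<close> by blast
      moreover obtain w' where "e = {v, w'}"
        using edge_other_endpoint sg \<open>e \<in> M\<close> \<open>v \<in> e\<close> * by (metis subsetD)
      ultimately show ?thesis using w by auto
    qed
    then show ?thesis using that * by blast
  qed
  then have "card {g \<in> edges G. g \<subseteq> \<Union>M \<and> v \<in> g} = 1" if "v \<in> \<Union>M" for v
    using that by fastforce
  then show "induced_matching G M"
    using * by (simp add: induced_matching_def regular_def induced_subgraph_def degree_def conj_assoc)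
qed

section \<open>Local optima of the search\<close>

lemma induced_matching_finite:
  assumes "simple_graph G" "induced_matching G M"
  shows "finite M"
  using assms finite_edges finite_subset by (auto simp: induced_matching_def)

lemma iteration_induced_matching:
  assumes "iteration G M M'" "induced_matching G M"
  shows "induced_matching G M'"
  using assms by (auto simp: iteration_def if_possible_def augment_def exchange_def split: if_splits)

lemma reachable_induced_matching:
  assumes "reachable G M"
  shows "induced_matching G M"
  using assms
proof induction
  case start
  show ?case by (simp add: induced_matching_def regular_def induced_subgraph_def)
next
  case continue
  then show ?case by (blast intro: iteration_induced_matching)
qed

lemma card_augment:
  assumes "augment G M M'" "finite M"
  shows "card M' = Suc (card M)"
  using assms by (auto simp: augment_def)

lemma card_exchange:
  assumes "exchange G M M'" "finite M"
  shows "card M' = Suc (card M)"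
proof -
  obtain e e' e'' where "e \<in> M" "e' \<notin> M" "e'' \<notin> M" "e' \<noteq> e''" "M' = (M - {e}) \<union> {e', e''}"
    using assms(1) unfolding exchange_def by auto
  moreover from this have "card M > 0" using assms(2) by (auto simp: card_gt_0_iff)
  ultimately show ?thesis using assms(2) by (simp add: card_insert_if)
qed

lemma local_search_output_locally_optimal:
  assumes sg: "simple_graph G" and "local_search_output G M"
  shows "induced_matching G M" "\<nexists>M'. augment G M M'" "\<nexists>M'. exchange G M M'"
proof -
  obtain M0 N where M0: "reachable G M0" and aug: "if_possible (augment G) M0 N"
    and exc: "if_possible (exchange G) N M" and card: "\<not> card M0 < card M"
    using assms(2) unfolding local_search_output_def iteration_def by blast
  have im0: "induced_matching G M0" by (rule reachable_induced_matching[OF M0])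
  have fin0: "finite M0" by (rule induced_matching_finite[OF sg im0])
  have imN: "induced_matching G N" 
    using aug im0 by (auto simp: if_possible_def augment_def split: if_splits)
  have finN: "finite N" by (rule induced_matching_finite[OF sg imN])
  have le: "card N \<le> card M"
    using exc card_exchange[OF _ finN] by (fastforce simp: if_possible_def split: if_splits)
  have no_aug: "\<nexists>M'. augment G M0 M'" and N: "N = M0"
    using aug card le card_augment[OF _ fin0] by (fastforce simp: if_possible_def split: if_splits)+
  have no_exc: "\<nexists>M'. exchange G N M'" and "M = N"
    using exc card N card_exchange[OF _ finN] by (fastforce simp: if_possible_def split: if_splits)+
  then show "induced_matching G M" "\<nexists>M'. augment G M M'" "\<nexists>M'. exchange G M M'"
    using N im0 no_aug by auto
qed

text \<open>An edge outside all conflict sets could be added to \<open>M\<close>.\<close>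

lemma conflict_sets_cover:
  assumes sg: "simple_graph G" and im: "induced_matching G M"
    and "\<nexists>M'. augment G M M'" and g: "g \<in> edges G"
  shows "\<exists>f\<in>M. g \<in> conflict_set G f"
proof (rule ccontr)
  assume "\<not> ?thesis"
  moreover have sub: "M \<subseteq> edges G" using im by (simp add: induced_matching_def)
  ultimately have no: "\<not> conflicting G f g" if "f \<in> M" for f
    using that g conflict_set_iff[OF sg] by blast
  have "g \<notin> M" using no conflicting_refl[OF sg g] by blast
  moreover have "induced_matching G (M \<union> {g})"
    using im no g conflicting_commute[of G] unfolding induced_matching_iff[OF sg] by blast
  ultimately have "augment G M (M \<union> {g})" unfolding augment_def using g by blast
  with assms(3) show False by blast
qed

text \<open>Two private conflicts of \<open>e\<close> that did not conflict could replace \<open>e\<close>.\<close>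

lemma private_conflicts_pairwise_conflicting:
  assumes sg: "simple_graph G" and im: "induced_matching G M"
    and no_exc: "\<nexists>M'. exchange G M M'" and e: "e \<in> M"
    and f: "f \<in> private_conflicts G M e" and f': "f' \<in> private_conflicts G M e"
  shows "conflicting G f f'"
proof (rule ccontr)
  assume nc: "\<not> conflicting G f f'"
  have sub: "M \<subseteq> edges G" using im by (simp add: induced_matching_def)
  have priv: "g \<in> edges G \<and> conflicting G e g \<and> (\<forall>h\<in>M - {e}. \<not> conflicting G h g)"
    if "g \<in> private_conflicts G M e" for g
  proof -
    have "g \<in> conflict_set G e" and ex: "\<And>h. h \<in> M - {e} \<Longrightarrow> g \<notin> conflict_set G h"
      using that by (auto simp: private_conflicts_def)
    moreover have "e \<in> edges G" using e sub by blast
    ultimately have g: "g \<in> edges G" "conflicting G e g" using conflict_set_iff[OF sg] by auto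
    have "\<not> conflicting G h g" if "h \<in> M - {e}" for h
    proof -
      have "h \<in> edges G" using that sub by blast
      from conflict_set_iff[OF sg this] show ?thesis using ex[OF that] g(1) by simp
    qed
    with g show ?thesis by blast
  qed
  have refl: "conflicting G g g" if "g \<in> edges G" for g
    by (rule conflicting_refl[OF sg that])
  \<comment> \<open>A member of \<open>M\<close> other than \<open>e\<close> conflicts with itself, so it is not private to \<open>e\<close>;
     and \<open>e\<close> conflicts with everything that is private to it.\<close>
  have "f \<noteq> f'" "f \<noteq> e" "f' \<noteq> e"
    using nc priv[OF f] priv[OF f'] refl conflicting_commute[of G] by blast+
  moreover have "f \<notin> M" "f' \<notin> M"
    using priv[OF f] priv[OF f'] refl \<open>f \<noteq> e\<close> \<open>f' \<noteq> e\<close> by blast+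
  moreover have "induced_matching G ((M - {e}) \<union> {f, f'})"
  proof -
    have "\<not> conflicting G f' f" using nc conflicting_commute[of G f f'] by simp
    moreover have "\<not> conflicting G h g" "\<not> conflicting G g h"
      if "h \<in> M - {e}" "g = f \<or> g = f'" for h g
    proof -
      show "\<not> conflicting G h g" using that priv[OF f] priv[OF f'] by auto
      then show "\<not> conflicting G g h" using conflicting_commute[of G h g] by simp
    qed
    moreover have "\<not> conflicting G h g" if "h \<in> M" "g \<in> M" "h \<noteq> g" for h g
      using im that unfolding induced_matching_iff[OF sg] by simp
    ultimately show ?thesis
      unfolding induced_matching_iff[OF sg] using nc sub priv[OF f] priv[OF f'] by auto
  qed
  ultimately have "exchange G M ((M - {e}) \<union> {f, f'})"
    unfolding exchange_def using e priv[OF f] priv[OF f']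
    by (intro exI[of _ e] exI[of _ f] exI[of _ f']) simp
  with no_exc show False by blast
qed

section \<open>Excluded cycles\<close>

lemma edges_cycle_graph_3: "edges (cycle_graph 3) = {{0, 1}, {1, 2}, {2, 0}}"
proof -
  have "{..<3::nat} = {0, 1, 2}" by auto
  then have "edges (cycle_graph 3) = (\<lambda>i. {i, Suc i mod 3}) ` {0, 1, 2}"
    by (auto simp: cycle_graph_def setcompr_eq_image lessThan_def)
  then show ?thesis by (simp flip: numeral_2_eq_2)
qed

lemma edges_cycle_graph_4: "edges (cycle_graph 4) = {{0, 1}, {1, 2}, {2, 3}, {3, 0}}"
proof -
  have "{..<4::nat} = {0, 1, 2, 3}" by auto
  then have "edges (cycle_graph 4) = (\<lambda>i. {i, Suc i mod 4}) ` {0, 1, 2, 3}"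
    by (auto simp: cycle_graph_def setcompr_eq_image lessThan_def)
  then show ?thesis by (simp flip: numeral_2_eq_2)
qed

lemma no_triangle:
  assumes sg: "simple_graph G" and "\<not> has_induced G (cycle_graph 3)"
    and ab: "{a, b} \<in> edges G" and bc: "{b, c} \<in> edges G" and ac: "{a, c} \<in> edges G"
  shows False
proof -
  have neq: "a \<noteq> b" "b \<noteq> c" "a \<noteq> c"
    using ab bc ac edge_endpoints_distinct[OF sg] by auto
  let ?f = "\<lambda>v. if v = a then 0 else if v = b then 1 else (2::nat)"
  have loop: "{v} \<notin> edges G" for v using edge_endpoints_distinct[OF sg, of v v] by auto
  have "bij_betw ?f {a, b, c} {..<3}"
    using neq by (auto simp: bij_betw_def inj_on_def image_def)
  moreover have "\<forall>u\<in>{a, b, c}. \<forall>v\<in>{a, b, c}.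
      {u, v} \<in> {e \<in> edges G. e \<subseteq> {a, b, c}} \<longleftrightarrow> {?f u, ?f v} \<in> edges (cycle_graph 3)"
    unfolding edges_cycle_graph_3
    using neq ab bc ac loop by (auto simp: doubleton_eq_iff insert_commute)
  ultimately have "isomorphic (induced_subgraph G {a, b, c}) (cycle_graph 3)"
    unfolding isomorphic_def induced_subgraph_def
    by (intro exI[of _ ?f]) (simp add: cycle_graph_def)
  moreover have "{a, b, c} \<subseteq> verts G" using sg ab bc by (auto simp: simple_graph_def)
  ultimately show False using assms(2) unfolding has_induced_def by blast
qed

text \<open>Forbidding induced 4-cycles excludes all 4-cycles, since a chord would create a triangle.\<close>

lemma no_4_cycle:
  assumes sg: "simple_graph G" and no3: "\<not> has_induced G (cycle_graph 3)"
    and "\<not> has_induced G (cycle_graph 4)"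
    and ab: "{a, b} \<in> edges G" and bc: "{b, c} \<in> edges G"
    and cd: "{c, d} \<in> edges G" and da: "{d, a} \<in> edges G"
    and "a \<noteq> c" "b \<noteq> d"
  shows False
proof -
  have neq: "a \<noteq> b" "b \<noteq> c" "c \<noteq> d" "d \<noteq> a"
    using ab bc cd da edge_endpoints_distinct[OF sg] by auto
  have adj: "{b, a} \<in> edges G" "{c, b} \<in> edges G" "{d, c} \<in> edges G" "{a, d} \<in> edges G"
    "{a, b} \<in> edges G" "{b, c} \<in> edges G" "{c, d} \<in> edges G" "{d, a} \<in> edges G"
    using ab bc cd da by (simp_all add: insert_commute)
  have "{a, c} \<notin> edges G" "{b, d} \<notin> edges G"
    using no_triangle[OF sg no3 ab bc] no_triangle[OF sg no3 bc cd] by auto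
  then have chord: "{a, c} \<notin> edges G" "{c, a} \<notin> edges G" "{b, d} \<notin> edges G" "{d, b} \<notin> edges G"
    by (simp_all add: insert_commute)
  let ?f = "\<lambda>v. if v = a then 0 else if v = b then 1 else if v = c then 2 else (3::nat)"
  have loop: "{v} \<notin> edges G" for v using edge_endpoints_distinct[OF sg, of v v] by auto
  have "{..<4::nat} = {3, 2, 1, 0}" by auto
  then have "bij_betw ?f {a, b, c, d} {..<4}"
    using neq neq[symmetric] assms(8,9) assms(8,9)[symmetric]
    by (simp add: bij_betw_def inj_on_def)
  moreover have "\<forall>u\<in>{a, b, c, d}. \<forall>v\<in>{a, b, c, d}.
      {u, v} \<in> {e \<in> edges G. e \<subseteq> {a, b, c, d}} \<longleftrightarrow> {?f u, ?f v} \<in> edges (cycle_graph 4)"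
    unfolding edges_cycle_graph_4
    using neq neq[symmetric] assms(8,9) assms(8,9)[symmetric] adj loop chord
    by (simp add: doubleton_eq_iff)
  ultimately have "isomorphic (induced_subgraph G {a, b, c, d}) (cycle_graph 4)"
    unfolding isomorphic_def induced_subgraph_def
    by (intro exI[of _ ?f]) (simp add: cycle_graph_def)
  moreover have "{a, b, c, d} \<subseteq> verts G" using sg ab cd by (auto simp: simple_graph_def)
  ultimately show False using assms(3) unfolding has_induced_def by blast
qed

section \<open>Neighbourhoods in a graph of bounded degree\<close>

lemma degree_le_max_degree:
  assumes "simple_graph G"
  shows "degree G v \<le> max_degree G"
proof (cases "v \<in> verts G")
  case True
  then show ?thesis using assms unfolding max_degree_def simple_graph_def by (intro Max_ge) auto
next
  case False
  then have none: "{e \<in> edges G. v \<in> e} = {}" using assms by (auto simp: simple_graph_def)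
  show ?thesis unfolding degree_def none by simp
qed

lemma card_other_edges_at_le:
  assumes "simple_graph G" "e \<in> edges G" "v \<in> e"
    and "F \<subseteq> {f \<in> edges G. v \<in> f} - {e}"
  shows "card F \<le> max_degree G - 1"
proof -
  let ?S = "{f \<in> edges G. v \<in> f}"
  have "finite ?S" using finite_edges[OF assms(1)] by simp
  then have "card F \<le> card (?S - {e})" using assms(4) by (intro card_mono) auto
  also have "\<dots> = degree G v - 1" using assms(2,3) by (simp add: degree_def)
  finally show ?thesis using degree_le_max_degree[OF assms(1), of v] by linarith
qed

lemma card_other_neighbours_le:
  assumes sg: "simple_graph G" and xy: "{x, y} \<in> edges G"
  shows "finite {a. {x, a} \<in> edges G \<and> a \<noteq> y}"
    and "card {a. {x, a} \<in> edges G \<and> a \<noteq> y} \<le> max_degree G - 1"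
proof -
  let ?N = "{a. {x, a} \<in> edges G \<and> a \<noteq> y}"
  have inj: "inj_on (\<lambda>a. {x, a}) ?N" by (auto simp: inj_on_def doubleton_eq_iff)
  have sub: "(\<lambda>a. {x, a}) ` ?N \<subseteq> {f \<in> edges G. x \<in> f} - {{x, y}}"
    by (auto simp: doubleton_eq_iff)
  have "finite ((\<lambda>a. {x, a}) ` ?N)"
    using finite_subset[OF sub] finite_edges[OF sg] by simp
  then show "finite ?N" using inj by (simp add: finite_image_iff)
  show "card ?N \<le> max_degree G - 1"
    using card_other_edges_at_le[OF sg xy _ sub] inj by (simp add: card_image)
qed

text \<open>Apart from \<open>{x, y}\<close>, a conflicting edge is incident with a neighbour of \<open>x\<close> other than
  \<open>y\<close>, or with a neighbour of \<open>y\<close> other than \<open>x\<close>.\<close>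

lemma card_conflict_set_le:
  assumes sg: "simple_graph G" and e: "e \<in> edges G"
  shows "card (conflict_set G e) \<le> 1 + 2 * (max_degree G * (max_degree G - 1))"
proof -
  obtain x y where xy: "e = {x, y}" "x \<noteq> y"
    using sg e by (auto simp: simple_graph_def card_2_iff)
  define star where "star v = {f \<in> edges G. v \<in> f}" for v
  define branch where "branch p q = (\<Union>a\<in>{a. {p, a} \<in> edges G \<and> a \<noteq> q}. star a)" for p q
  have card_branch: "card (branch p q) \<le> max_degree G * (max_degree G - 1)"
    if "{p, q} \<in> edges G" for p q
  proof -
    let ?N = "{a. {p, a} \<in> edges G \<and> a \<noteq> q}"
    have "card (branch p q) \<le> (\<Sum>a\<in>?N. card (star a))"
      unfolding branch_def by (rule card_UN_le[OF card_other_neighbours_le(1)[OF sg that]])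
    also have "\<dots> \<le> (\<Sum>a\<in>?N. max_degree G)"
      using degree_le_max_degree[OF sg] by (intro sum_mono) (simp add: star_def degree_def)
    also have "\<dots> = max_degree G * card ?N" by simp
    also have "\<dots> \<le> max_degree G * (max_degree G - 1)"
      using card_other_neighbours_le(2)[OF sg that] by (rule mult_le_mono2)
    finally show ?thesis .
  qed
  have in_branch: "f \<in> branch p q"
    if "f \<in> edges G" "{p, v} \<in> edges G" "v \<in> f" "v \<noteq> q" for f p q v
    using that by (auto simp: branch_def star_def)
  have incident: "f \<in> insert {p, q} (branch p q)" if f: "f \<in> edges G" "p \<in> f" for f p q
  proof -
    obtain w where w: "f = {p, w}" using edge_other_endpoint sg f by metis
    show ?thesis using in_branch[of f p w q] f w by (cases "w = q") auto
  qed
  have sub: "conflict_set G e \<subseteq> {e} \<union> (branch x y \<union> branch y x)"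
  proof
    fix f assume "f \<in> conflict_set G e"
    then have f: "f \<in> edges G" and "conflicting G e f" using conflict_set_iff[OF sg e] by auto
    then obtain u v where "u \<in> {x, y}" "v \<in> f" "{u, v} \<in> edges G"
      unfolding conflicting_def xy by blast
    moreover have "f \<in> {e} \<union> (branch x y \<union> branch y x)" if "x \<in> f \<or> y \<in> f"
      using incident[of f x y] incident[of f y x] f that xy by (auto simp: insert_commute)
    ultimately show "f \<in> {e} \<union> (branch x y \<union> branch y x)"
      using in_branch[of f x v y] in_branch[of f y v x] f by blast
  qed
  have fin: "finite (branch p q)" for p q
    using finite_edges[OF sg] by (rule finite_subset[rotated]) (auto simp: branch_def star_def)
  have "card (conflict_set G e) \<le> card ({e} \<union> (branch x y \<union> branch y x))"
    using fin by (intro card_mono sub) auto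
  also have "\<dots> \<le> card {e} + (card (branch x y) + card (branch y x))"
    by (intro order_trans[OF card_Un_le] add_mono card_Un_le order_refl)
  also have "\<dots> \<le> 1 + 2 * (max_degree G * (max_degree G - 1))"
    using card_branch[of x y] card_branch[of y x] e xy by (simp add: insert_commute)
  finally show ?thesis .
qed

section \<open>Pairwise conflicting edges without short cycles\<close>

definition far_edges :: "'a graph \<Rightarrow> 'a set set \<Rightarrow> 'a \<Rightarrow> 'a \<Rightarrow> 'a set set" where
  "far_edges G K x y =
     {f \<in> K. \<exists>a z. f = {a, z} \<and> {x, a} \<in> edges G \<and> a \<noteq> y \<and> z \<noteq> x}"

definition wing :: "'a graph \<Rightarrow> 'a set set \<Rightarrow> 'a \<Rightarrow> 'a \<Rightarrow> 'a set set" where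
  "wing G K x y = {f \<in> K. y \<in> f \<and> x \<notin> f} \<union> far_edges G K x y"

text \<open>Let \<open>Q\<close> be the far edges and \<open>P\<close> the edges at \<open>y\<close>. The absence of short cycles leaves few ways
  to conflict: \<open>{a, z} \<in> Q\<close> and \<open>{y, b} \<in> P\<close> do so only through \<open>{z, b}\<close>, and two far edges
  \<open>{a, z}\<close>, \<open>{a', z'}\<close> with \<open>a \<noteq> a'\<close> only through \<open>{z, z'}\<close>. If \<open>Q\<close> has an edge, two edges in
  \<open>P\<close> would close a 4-cycle through \<open>y\<close> and \<open>z\<close>. If \<open>Q\<close> has two edges, any edge in \<open>P\<close> would
  close a cycle of length 3 or 4. If \<open>Q\<close> is not contained in the star of one neighbour \<open>a\<close> of \<open>x\<close>,
  it has only two elements, because a third would again close such a cycle; and inside the star of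
  \<open>a\<close> it misses \<open>{x, a}\<close>.\<close>

lemma card_wing_le:
  assumes sg: "simple_graph G" and no3: "\<not> has_induced G (cycle_graph 3)"
    and no4: "\<not> has_induced G (cycle_graph 4)" and d: "3 \<le> max_degree G"
    and K: "K \<subseteq> edges G" and conf: "\<And>f g. f \<in> K \<Longrightarrow> g \<in> K \<Longrightarrow> conflicting G f g"
    and xy: "{x, y} \<in> edges G"
  shows "card (wing G K x y) \<le> max_degree G - 1"
proof -
  define P where "P = {f \<in> K. y \<in> f \<and> x \<notin> f}"
  define Q where "Q = far_edges G K x y"
  let ?adj = "\<lambda>u v. {u, v} \<in> edges G"
  have sym: "?adj u v \<longleftrightarrow> ?adj v u" for u v by (simp add: insert_commute)
  note tri = no_triangle[OF sg no3]
  note quad = no_4_cycle[OF sg no3 no4]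
  have finK: "finite K" using K finite_edges[OF sg] finite_subset by blast
  then have fin: "finite P" "finite Q" by (auto simp: P_def Q_def far_edges_def)
  have P_E: "\<exists>b. f = {y, b} \<and> f \<in> K \<and> ?adj y b \<and> b \<noteq> x" if "f \<in> P" for f
  proof -
    have "f \<in> K" "f \<in> edges G" "y \<in> f" "x \<notin> f" using that K by (auto simp: P_def)
    moreover obtain b where "f = {y, b}" using edge_other_endpoint sg \<open>f \<in> edges G\<close> \<open>y \<in> f\<close> by metis
    ultimately show ?thesis by auto
  qed
  have Q_E: "\<exists>a z. f = {a, z} \<and> f \<in> K \<and> ?adj x a \<and> ?adj a z \<and> a \<noteq> y \<and> z \<noteq> x \<and> z \<noteq> y"
    if "f \<in> Q" for f
  proof -
    obtain a z where "f = {a, z}" "f \<in> K" "?adj x a" "a \<noteq> y" "z \<noteq> x"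
      using \<open>f \<in> Q\<close> by (auto simp: Q_def far_edges_def)
    moreover have "?adj a z" using K calculation by blast
    moreover have "z \<noteq> y" using tri[OF \<open>?adj x a\<close>, of y] \<open>?adj a z\<close> xy by blast
    ultimately show ?thesis by blast
  qed
  have QP: "?adj z b"
    if "{a, z} \<in> K" "?adj x a" "?adj a z" "a \<noteq> y" "z \<noteq> x" "{y, b} \<in> K" "?adj y b" "b \<noteq> x"
    for a z b
  proof -
    have "conflicting G {a, z} {y, b}" using conf that by blast
    moreover have "\<not> ?adj a y" using tri that xy by blast
    moreover have "\<not> ?adj a b" using quad[of x a b y] that xy sym by blast
    moreover have "\<not> ?adj z y" using quad[of x a z y] that xy sym by blast
    ultimately show ?thesis unfolding conflicting_def by blast
  qed
  have QQ: "?adj z z'"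
    if "{a, z} \<in> K" "?adj x a" "?adj a z" "z \<noteq> x"
      "{a', z'} \<in> K" "?adj x a'" "?adj a' z'" "z' \<noteq> x" "a \<noteq> a'" for a z a' z'
  proof -
    have "conflicting G {a, z} {a', z'}" using conf that by blast
    moreover have "\<not> ?adj a a'" using tri that by blast
    moreover have "\<not> ?adj a z'" using quad[of x a z' a'] that sym by blast
    moreover have "\<not> ?adj z a'" using quad[of x a z a'] that sym by blast
    ultimately show ?thesis unfolding conflicting_def by blast
  qed
  have P_le: "card P \<le> max_degree G - 1"
    by (rule card_other_edges_at_le[OF sg xy, of y]) (use K in \<open>auto simp: P_def\<close>)
  have P_one: "card P \<le> 1" if "f \<in> Q" for f
  proof -
    obtain a z where f: "{a, z} \<in> K" "?adj x a" "?adj a z" "a \<noteq> y" "z \<noteq> x" "z \<noteq> y"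
      using Q_E[OF \<open>f \<in> Q\<close>] by blast
    have "g = g'" if "g \<in> P" "g' \<in> P" for g g'
    proof -
      obtain b where b: "g = {y, b}" "{y, b} \<in> K" "?adj y b" "b \<noteq> x" using P_E[OF \<open>g \<in> P\<close>] by blast
      obtain b' where b': "g' = {y, b'}" "{y, b'} \<in> K" "?adj y b'" "b' \<noteq> x"
        using P_E[OF \<open>g' \<in> P\<close>] by blast
      have "?adj z b" "?adj z b'" using QP f b b' by blast+
      then have "b = b'" using quad[of y b z b'] b b' f(6) sym by blast
      then show ?thesis using b b' by simp
    qed
    then show ?thesis using fin(1) by (simp add: card_le_Suc0_iff_eq)
  qed
  have P_empty: "P = {}" if "f \<in> Q" "f' \<in> Q" "f \<noteq> f'" for f f'
  proof (rule ccontr)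
    assume "P \<noteq> {}"
    then obtain b where b: "{y, b} \<in> K" "?adj y b" "b \<noteq> x" using P_E by blast
    obtain a z where f: "f = {a, z}" "{a, z} \<in> K" "?adj x a" "?adj a z" "a \<noteq> y" "z \<noteq> x"
      using Q_E[OF \<open>f \<in> Q\<close>] by blast
    obtain a' z' where f': "f' = {a', z'}" "{a', z'} \<in> K" "?adj x a'" "?adj a' z'" "a' \<noteq> y" "z' \<noteq> x"
      using Q_E[OF \<open>f' \<in> Q\<close>] by blast
    have zb: "?adj z b" "?adj z' b" using QP f f' b by blast+
    show False
    proof (cases "a = a'")
      case True
      then have "z \<noteq> z'" using f f' \<open>f \<noteq> f'\<close> by blast
      moreover have "a \<noteq> b" using tri[of x a y] f b xy sym by blast
      ultimately show False using quad[of a z b z'] True zb f f' sym by blast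
    next
      case False
      then have "?adj z z'" using QQ f f' by blast
      then show False using tri zb by blast
    qed
  qed
  have Q_le: "card Q \<le> max_degree G - 1"
  proof (cases "\<exists>a. ?adj x a \<and> Q \<subseteq> {f \<in> edges G. a \<in> f} - {{x, a}}")
    case True
    then show ?thesis using card_other_edges_at_le[OF sg] by blast
  next
    case False
    show ?thesis
    proof (cases "Q = {}")
      case True
      then show ?thesis by simp
    next
      case nonempty: False
      then obtain f where "f \<in> Q" by blast
      then obtain a z where f: "f = {a, z}" "{a, z} \<in> K" "?adj x a" "?adj a z" "z \<noteq> x"
        using Q_E[OF \<open>f \<in> Q\<close>] by blast
      have "\<exists>f'\<in>Q. a \<notin> f'"
      proof (rule ccontr)
        assume "\<not> ?thesis"
        then have "a \<in> g" if "g \<in> Q" for g using that by blast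
        moreover have "x \<notin> g" if "g \<in> Q" for g
          using Q_E[OF that] edge_endpoints_distinct[OF sg] by blast
        ultimately have "Q \<subseteq> {f \<in> edges G. a \<in> f} - {{x, a}}"
          using Q_E K by blast
        with False f(3) show False by blast
      qed
      then obtain f' where "f' \<in> Q" "a \<notin> f'" by blast
      then obtain a' z' where f': "f' = {a', z'}" "{a', z'} \<in> K" "?adj x a'" "?adj a' z'" "z' \<noteq> x"
        and aa': "a \<noteq> a'" "a \<noteq> z'"
        using Q_E[OF \<open>f' \<in> Q\<close>] by blast
      have zz': "?adj z z'" using QQ f f' aa' by blast
      have "g \<in> {f, f'}" if "g \<in> Q" for g
      proof -
        obtain c w where g: "g = {c, w}" "{c, w} \<in> K" "?adj x c" "?adj c w" "w \<noteq> x"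
          using Q_E[OF \<open>g \<in> Q\<close>] by blast
        consider "c = a" | "c = a'" | "c \<noteq> a" "c \<noteq> a'" by blast
        then show ?thesis
        proof cases
          case 1
          then have "?adj w z'" using QQ g f' aa' by blast
          then have "w = z" using quad[of a z z' w] 1 f g zz' aa' sym by blast
          then show ?thesis using 1 f g by simp
        next
          case 2
          then have "?adj w z" using QQ g f aa' by blast
          moreover have "a' \<noteq> z" using tri[of x a a'] f f' by blast
          ultimately have "w = z'" using quad[of a' z' z w] 2 f' g zz' sym by blast
          then show ?thesis using 2 f' g by simp
        next
          case 3
          then have "?adj w z" "?adj w z'" using QQ f f' g by blast+
          then show ?thesis using tri zz' by blast
        qed
      qed
      then have "card Q \<le> card {f, f'}" by (intro card_mono) auto
      also have "\<dots> \<le> 2" by (simp add: card_insert_if)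
      finally show ?thesis using d by simp
    qed
  qed
  have "card P + card Q \<le> max_degree G - 1"
  proof -
    consider "Q = {}" | "card Q = 1" | "\<exists>f\<in>Q. \<exists>f'\<in>Q. f \<noteq> f'"
    proof (cases "card Q \<le> 1")
      case True
      then show ?thesis using that(1,2) fin(2) by (cases "card Q") auto
    next
      case False
      then show ?thesis using that(3) fin(2) by (auto simp: card_le_Suc0_iff_eq)
    qed
    then show ?thesis
    proof cases
      case 1
      then show ?thesis using P_le by simp
    next
      case 2
      then have "card P \<le> 1" using P_one by (metis card_1_singletonE singletonI)
      then show ?thesis using 2 d by simp
    next
      case 3
      then have "P = {}" using P_empty by blast
      then show ?thesis using Q_le by simp
    qed
  qed
  then show ?thesis
    using card_Un_le[of P Q] by (simp add: wing_def P_def Q_def)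
qed

lemma card_pairwise_conflicting_le:
  assumes sg: "simple_graph G" and no3: "\<not> has_induced G (cycle_graph 3)"
    and no4: "\<not> has_induced G (cycle_graph 4)" and d: "3 \<le> max_degree G"
    and K: "K \<subseteq> edges G" and conf: "\<And>f g. f \<in> K \<Longrightarrow> g \<in> K \<Longrightarrow> conflicting G f g"
    and e: "e \<in> edges G" and eK: "\<And>f. f \<in> K \<Longrightarrow> conflicting G e f"
  shows "card K \<le> 2 * max_degree G - 1"
proof -
  obtain x y where xy: "e = {x, y}" "x \<noteq> y"
    using sg e by (auto simp: simple_graph_def card_2_iff)
  have far: "f \<in> far_edges G K p q"
    if f: "f \<in> K" and "p \<notin> f" "q \<notin> f" "v \<in> f" "{p, v} \<in> edges G" for f p q v
  proof -
    obtain z where "f = {v, z}" using edge_other_endpoint sg f K \<open>v \<in> f\<close> by (metis subsetD)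
    then show ?thesis using that unfolding far_edges_def by blast
  qed
  have sub: "K \<subseteq> {e} \<union> (wing G K x y \<union> wing G K y x)"
  proof
    fix f assume f: "f \<in> K"
    then obtain u v where uv: "u \<in> {x, y}" "v \<in> f" "{u, v} \<in> edges G"
      using eK xy unfolding conflicting_def by blast
    have "f = e" if "x \<in> f" "y \<in> f"
    proof -
      obtain w where "f = {x, w}" using edge_other_endpoint sg f K \<open>x \<in> f\<close> by (metis subsetD)
      with that xy show ?thesis by auto
    qed
    moreover have "f \<in> wing G K x y \<union> wing G K y x" if "\<not> (x \<in> f \<and> y \<in> f)"
    proof (cases "x \<in> f \<or> y \<in> f")
      case True
      then show ?thesis using that f by (auto simp: wing_def)
    next
      case False
      then show ?thesis using far[of f x y v] far[of f y x v] f uv by (auto simp: wing_def)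
    qed
    ultimately show "f \<in> {e} \<union> (wing G K x y \<union> wing G K y x)" by blast
  qed
  have "finite K" using K finite_edges[OF sg] finite_subset by blast
  then have fin: "finite (wing G K p q)" for p q by (simp add: wing_def far_edges_def)
  have "card K \<le> card ({e} \<union> (wing G K x y \<union> wing G K y x))"
    using fin by (intro card_mono sub) auto
  also have "\<dots> \<le> card {e} + (card (wing G K x y) + card (wing G K y x))"
    by (intro order_trans[OF card_Un_le] add_mono card_Un_le order_refl)
  also have "\<dots> \<le> 1 + ((max_degree G - 1) + (max_degree G - 1))"
    using e xy card_wing_le[OF sg no3 no4 d K conf, of x y]
      card_wing_le[OF sg no3 no4 d K conf, of y x]
    by (simp add: insert_commute)
  finally show ?thesis using d by simp
qed

section \<open>Double counting\<close>

text \<open>An edge in only one of the conflict sets is private there, and is then counted a second time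
  by \<open>pc\<close>.\<close>

lemma twice_card_edges_le:
  assumes sg: "simple_graph G" and fin: "finite M"
    and cover: "\<And>g. g \<in> edges G \<Longrightarrow> \<exists>f\<in>M. g \<in> conflict_set G f"
  shows "2 * card (edges G) \<le> (\<Sum>f\<in>M. card (conflict_set G f) + pc G M f)"
proof -
  let ?E = "edges G"
  let ?C = "conflict_set G" and ?PC = "private_conflicts G M"
  have finE: "finite ?E" by (rule finite_edges[OF sg])
  have count: "card A = (\<Sum>g\<in>?E. of_bool (g \<in> A))" if "A \<subseteq> ?E" for A
    using that finE by (simp add: Int_absorb1)
  have C_sub: "?C f \<subseteq> ?E" for f by (auto simp: conflict_set_def)
  then have PC_sub: "?PC f \<subseteq> ?E" for f by (auto simp: private_conflicts_def)
  have "2 \<le> (\<Sum>f\<in>M. of_bool (g \<in> ?C f) + of_bool (g \<in> ?PC f) :: nat)" if g: "g \<in> ?E" for g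
  proof -
    obtain f where f: "f \<in> M" "g \<in> ?C f" using cover[OF g] by blast
    let ?t = "\<lambda>f. of_bool (g \<in> ?C f) + of_bool (g \<in> ?PC f) :: nat"
    show ?thesis
    proof (cases "g \<in> ?PC f")
      case True
      then have "2 = ?t f" using f by simp
      also have "\<dots> \<le> (\<Sum>f\<in>M. ?t f)" by (rule member_le_sum[OF f(1)]) (use fin in auto)
      finally show ?thesis .
    next
      case False
      then obtain f' where f': "f' \<in> M" "f' \<noteq> f" "g \<in> ?C f'"
        using f by (auto simp: private_conflicts_def)
      have "2 \<le> ?t f + ?t f'" using f f' by simp
      also have "\<dots> = (\<Sum>f\<in>{f, f'}. ?t f)" using f'(2) by simp
      also have "\<dots> \<le> (\<Sum>f\<in>M. ?t f)" by (rule sum_mono2) (use fin f f' in auto)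
      finally show ?thesis .
    qed
  qed
  then have "(\<Sum>g\<in>?E. 2) \<le> (\<Sum>g\<in>?E. \<Sum>f\<in>M. of_bool (g \<in> ?C f) + of_bool (g \<in> ?PC f) :: nat)"
    by (rule sum_mono)
  also have "\<dots> = (\<Sum>f\<in>M. \<Sum>g\<in>?E. of_bool (g \<in> ?C f) + of_bool (g \<in> ?PC f))"
    by (rule sum.swap)
  also have "\<dots> = (\<Sum>f\<in>M. card (?C f) + pc G M f)"
    unfolding pc_def by (simp only: sum.distrib count[OF C_sub] count[OF PC_sub])
  finally show ?thesis by simp
qed

theorem theorem5:
  fixes d :: nat and G :: "'a graph" and M :: "'a set set"
  assumes "d \<ge> 3"
    and "simple_graph G"
    and "\<not> has_induced G (cycle_graph 3)"
    and "\<not> has_induced G (cycle_graph 4)"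
    and "max_degree G = d"
    and "local_search_output G M"
  shows "(\<forall>e\<in>M. pc G M e \<le> 2 * d - 1) \<and>
         real (card M) \<ge> real (card (edges G)) / real d ^ 2"
proof -
  note sg = \<open>simple_graph G\<close>
  note opt = local_search_output_locally_optimal[OF sg assms(6)]
  have M: "M \<subseteq> edges G" using opt(1) by (simp add: induced_matching_def)
  have pc_le: "pc G M e \<le> 2 * d - 1" if e: "e \<in> M" for e
  proof -
    have eE: "e \<in> edges G" using e M by blast
    have "private_conflicts G M e \<subseteq> edges G"
      by (auto simp: private_conflicts_def conflict_set_def)
    moreover have "conflicting G e f" if "f \<in> private_conflicts G M e" for f
      using that by (simp add: private_conflicts_def conflict_set_iff[OF sg eE])
    ultimately show ?thesis
      unfolding pc_def
      using card_pairwise_conflicting_le[OF sg assms(3,4) _ _ _ eE, of "private_conflicts G M e"]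
        private_conflicts_pairwise_conflicting[OF sg opt(1,3) e] assms(1,5)
      by blast
  qed
  have "2 * card (edges G) \<le> (\<Sum>f\<in>M. card (conflict_set G f) + pc G M f)"
    using twice_card_edges_le[OF sg induced_matching_finite[OF sg opt(1)]]
      conflict_sets_cover[OF sg opt(1,2)] by blast
  also have "\<dots> \<le> (\<Sum>f\<in>M. 2 * d\<^sup>2)"
  proof (rule sum_mono)
    fix f assume f: "f \<in> M"
    have "card (conflict_set G f) + pc G M f \<le> (1 + 2 * (d * (d - 1))) + (2 * d - 1)"
      using card_conflict_set_le[OF sg, of f] pc_le[OF f] f M assms(5) by (intro add_mono) auto
    also have "\<dots> = 2 * d\<^sup>2"
      using assms(1) by (cases d) (auto simp: power2_eq_square)
    finally show "card (conflict_set G f) + pc G M f \<le> 2 * d\<^sup>2" .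
  qed
  finally have "card (edges G) \<le> card M * d\<^sup>2" by simp
  then have "real (card (edges G)) \<le> real (card M) * real d ^ 2"
    by (metis of_nat_le_iff of_nat_mult of_nat_power)
  moreover have "real d ^ 2 > 0" using assms(1) by simp
  ultimately have "real (card (edges G)) / real d ^ 2 \<le> real (card M)"
    by (simp add: divide_le_eq)
  with pc_le show ?thesis by blast
qed

end
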